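(* Let $\mathbb D=\langle D,\leq_{\mathbb D}\rangle$ be a directed set such that Player II has no winning strategy in the game $\mathcal G(\mathbb D)$. If $\mathbb I$ is an inverse system of sets over $\mathbb D$ whose inverse limit $A_{\mathbb I}$ is non-empty, then the inverse limit $G_{\mathbb I_{gr}}$ is a free group of cardinality $\max\{\aleph_0,|A_{\mathbb I}|\}$.
   Context: A directed set is a pair $\langle D,\leq_{\mathbb D}\rangle$ with $\leq_{\mathbb D}$ reflexive and transitive on $D$ such that any two elements have a common upper bound. An inverse system of sets over $\mathbb D$ is $\mathbb I=\langle\langle A_p: p\in D\rangle,\langle f_{p,q}: p\leq_{\mathbb D} q\rangle\rangle$ with each $A_p$ non-empty, $f_{p,q}:A_q\to A_p$, $f_{p,p}=\mathrm{id}$, $f_{p,q}\circ f_{q,r}=f_{p,r}$ for $p\leq q\leq r$; its inverse limit is $A_{\mathbb I}=\{(a_p)_{p\in D}: f_{p,q}(a_q)=a_p\text{ for all }p\leq_{\mathbb D} q\}$. $\mathbb I_{gr}$ is the inverse system of groups where $G_p$ is the free group on generators $\{x_{p,a}: a\in A_p\}$ and $h_{p,q}:G_q\to G_p$ is the homomorphism with $h_{p,q}(x_{q,a})=x_{p,f_{p,q}(a)}$; its inverse limit is $G_{\mathbb I_{gr}}=\{(g_p)\in\prod_p G_p: h_{p,q}(g_q)=g_p\text{ for all }p\leq_{\mathbb D} q\}$. The game $\mathcal G(\mathbb D)$: in round $i<\omega$, Player I chooses $p_{2i}\in D$ and then Player II chooses $p_{2i+1}\in D$. Player I wins the run $(p_i)_{i<\omega}$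 iff either there is $i$ with $p_{2i}\not\leq_{\mathbb D} p_{2i+1}$, or $p_{2i+1}\leq_{\mathbb D}p_{2i+2}$ for all $i<\omega$ and there is $p\in D$ with $p_i\leq_{\mathbb D} p$ for all $i$. A winning strategy for Player II is a function $s:{}^{<\omega}D\to D$ such that Player II wins every run with $s(\langle p_0,\dots,p_{2i}\rangle)=p_{2i+1}$ for all $i$. *)

theory Defs
  imports "HOL-Algebra.Product_Groups"
begin

unbundle cardinal_syntax

section \<open>Free groups\<close>

text \<open>
  The letter \<open>(a, True)\<close> is the generator \<open>x\<^sub>a\<close>, and \<open>(a, False)\<close> is its inverse.
  The free group on \<open>X\<close> consists of the reduced words over \<open>X\<close>; multiplying is
  pushing the letters of the left factor onto the right one, cancelling where possible.
\<close>

definition inv_letter :: "'a \<times> bool \<Rightarrow> 'a \<times> bool" where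
  "inv_letter x = (fst x, \<not> snd x)"

definition reduced :: "('a \<times> bool) list \<Rightarrow> bool" where
  "reduced w \<longleftrightarrow> successively (\<lambda>x y. y \<noteq> inv_letter x) w"

fun push_letter :: "'a \<times> bool \<Rightarrow> ('a \<times> bool) list \<Rightarrow> ('a \<times> bool) list" where
  "push_letter x [] = [x]"
| "push_letter x (y # w) = (if y = inv_letter x then w else x # y # w)"

definition free_group :: "'a set \<Rightarrow> ('a \<times> bool) list monoid" where
  "free_group X =
    \<lparr>carrier = {w \<in> lists (X \<times> UNIV). reduced w},
     monoid.mult = (\<lambda>u v. foldr push_letter u v),
     one = []\<rparr>"

definition free_gen :: "'a \<Rightarrow> ('a \<times> bool) list" where
  "free_gen a = [(a, True)]"

definition letter_value :: "('b, 'c) monoid_scheme \<Rightarrow> ('a \<Rightarrow> 'b) \<Rightarrow> 'a \<times> bool \<Rightarrow> 'b" where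
  "letter_value G \<phi> x = (if snd x then \<phi> (fst x) else inv\<^bsub>G\<^esub> (\<phi> (fst x)))"

text \<open>
  The homomorphism out of the free group that extends a map \<open>\<phi>\<close> of the generators; see
  \<open>free_lift_hom\<close>, \<open>free_lift_gen\<close> and \<open>free_lift_unique\<close> below.
\<close>

definition free_lift ::
  "('b, 'c) monoid_scheme \<Rightarrow> ('a \<Rightarrow> 'b) \<Rightarrow> ('a \<times> bool) list \<Rightarrow> 'b" where
  "free_lift G \<phi> w = foldr (\<lambda>x y. letter_value G \<phi> x \<otimes>\<^bsub>G\<^esub> y) w \<one>\<^bsub>G\<^esub>"

definition free_basis :: "('a, 'b) monoid_scheme \<Rightarrow> 'a set \<Rightarrow> bool" where
  "free_basis G X \<longleftrightarrow> X \<subseteq> carrier G \<and> free_lift G (\<lambda>x. x) \<in> iso (free_group X) G"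

definition is_free_group :: "('a, 'b) monoid_scheme \<Rightarrow> bool" where
  "is_free_group G \<longleftrightarrow> group G \<and> (\<exists>X. free_basis G X)"

lemma inv_letter_inv_letter [simp]: "inv_letter (inv_letter x) = x"
  by (simp add: inv_letter_def)

lemma inv_letter_neq [simp]: "inv_letter x \<noteq> x" "x \<noteq> inv_letter x"
  by (auto simp: inv_letter_def prod_eq_iff)

lemma fst_inv_letter [simp]: "fst (inv_letter x) = fst x"
  by (simp add: inv_letter_def)

lemma reduced_simps [simp]:
  "reduced []" "reduced [x]"
  "reduced (x # y # w) \<longleftrightarrow> y \<noteq> inv_letter x \<and> reduced (y # w)"
  by (simp_all add: reduced_def)

lemma reduced_tl: "reduced (x # w) \<Longrightarrow> reduced w"
  by (cases w) auto

lemma reduced_push: "reduced w \<Longrightarrow> reduced (push_letter x w)"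
  by (cases w) (auto dest: reduced_tl)

lemma push_letter_reduced: "reduced (x # w) \<Longrightarrow> push_letter x w = x # w"
  by (cases w) auto

lemma reduced_foldr_push: "reduced v \<Longrightarrow> reduced (foldr push_letter u v)"
  by (induction u) (auto intro: reduced_push)

lemma push_push_inv: "reduced w \<Longrightarrow> push_letter x (push_letter (inv_letter x) w) = w"
  by (cases w) (auto simp: push_letter_reduced)

lemma foldr_push_push:
  assumes "reduced w"
  shows "foldr push_letter (push_letter x u) w = push_letter x (foldr push_letter u w)"
proof (cases u)
  case (Cons y u')
  have "push_letter x (push_letter (inv_letter x) (foldr push_letter u' w)) = foldr push_letter u' w"
    by (intro push_push_inv reduced_foldr_push assms)
  with Cons show ?thesis by auto
qed simp

lemma foldr_push_assoc:
  assumes "reduced w"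
  shows "foldr push_letter (foldr push_letter u v) w = foldr push_letter u (foldr push_letter v w)"
  by (induction u) (simp_all add: foldr_push_push assms)

lemma foldr_push_Nil: "reduced w \<Longrightarrow> foldr push_letter w [] = w"
proof (induction w)
  case (Cons x w)
  then have "foldr push_letter w [] = w" by (blast dest: reduced_tl)
  with Cons.prems show ?case by (simp add: push_letter_reduced)
qed simp

lemma push_letter_in_lists:
  "fst x \<in> X \<Longrightarrow> w \<in> lists (X \<times> UNIV) \<Longrightarrow> push_letter x w \<in> lists (X \<times> UNIV)"
  by (cases w; cases x) auto

lemma foldr_push_in_lists:
  "u \<in> lists (X \<times> UNIV) \<Longrightarrow> v \<in> lists (X \<times> UNIV) \<Longrightarrow>
    foldr push_letter u v \<in> lists (X \<times> UNIV)"
proof (induction u)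
  case (Cons x u)
  then show ?case using push_letter_in_lists[of x X "foldr push_letter u v"] by (cases x) simp
qed simp

lemma foldr_push_inverse:
  "reduced w \<Longrightarrow> foldr push_letter (map inv_letter (rev u)) (foldr push_letter u w) = w"
proof (induction u arbitrary: w)
  case (Cons x u)
  have "push_letter (inv_letter x) (push_letter x (foldr push_letter u w)) = foldr push_letter u w"
    using push_push_inv[of "foldr push_letter u w" "inv_letter x"]
    by (simp add: reduced_foldr_push Cons.prems)
  with Cons show ?case by simp
qed simp

lemma group_free_group: "group (free_group X)"
proof (rule groupI)
  fix w assume w: "w \<in> carrier (free_group X)"
  let ?v = "foldr push_letter (map inv_letter (rev w)) []"
  have "map inv_letter (rev w) \<in> lists (X \<times> UNIV)"
    using w by (fastforce simp: free_group_def inv_letter_def)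
  then have "?v \<in> carrier (free_group X)"
    using foldr_push_in_lists[of _ X "[]"] reduced_foldr_push[of "[]"]
    by (simp add: free_group_def del: in_lists_conv_set lists_image)
  moreover have "?v \<otimes>\<^bsub>free_group X\<^esub> w = \<one>\<^bsub>free_group X\<^esub>"
    using w foldr_push_inverse[of "[]" w]
    by (simp add: free_group_def foldr_push_assoc foldr_push_Nil)
  ultimately show "\<exists>v\<in>carrier (free_group X). v \<otimes>\<^bsub>free_group X\<^esub> w = \<one>\<^bsub>free_group X\<^esub>"
    by blast
qed (simp_all add: free_group_def foldr_push_assoc reduced_foldr_push foldr_push_in_lists
      del: in_lists_conv_set)

lemma free_gen_closed: "a \<in> X \<Longrightarrow> free_gen a \<in> carrier (free_group X)"
  by (simp add: free_gen_def free_group_def)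

context group
begin

lemma letter_value_closed:
  "\<phi> \<in> X \<rightarrow> carrier G \<Longrightarrow> fst x \<in> X \<Longrightarrow> letter_value G \<phi> x \<in> carrier G"
  by (auto simp: letter_value_def)

lemma free_lift_closed:
  "\<phi> \<in> X \<rightarrow> carrier G \<Longrightarrow> w \<in> lists (X \<times> UNIV) \<Longrightarrow> free_lift G \<phi> w \<in> carrier G"
proof (induction w)
  case (Cons x w)
  then show ?case using letter_value_closed[of \<phi> X x] by (cases x) (simp add: free_lift_def)
qed (simp add: free_lift_def)

lemma free_lift_Cons:
  "free_lift G \<phi> (x # w) = letter_value G \<phi> x \<otimes> free_lift G \<phi> w"
  by (simp add: free_lift_def)

lemma letter_value_inv:
  assumes "\<phi> \<in> X \<rightarrow> carrier G" "fst x \<in> X"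
  shows "letter_value G \<phi> x \<otimes> letter_value G \<phi> (inv_letter x) = \<one>"
proof -
  have "\<phi> (fst x) \<in> carrier G" using assms by auto
  then show ?thesis by (simp add: letter_value_def inv_letter_def)
qed

lemma free_lift_push:
  assumes \<phi>: "\<phi> \<in> X \<rightarrow> carrier G" and x: "fst x \<in> X" and w: "w \<in> lists (X \<times> UNIV)"
  shows "free_lift G \<phi> (push_letter x w) = letter_value G \<phi> x \<otimes> free_lift G \<phi> w"
proof (cases "\<exists>v. w = inv_letter x # v")
  case True
  then obtain v where v: "w = inv_letter x # v" by blast
  have cl: "free_lift G \<phi> v \<in> carrier G" "letter_value G \<phi> x \<in> carrier G"
    "letter_value G \<phi> (inv_letter x) \<in> carrier G"
    using w v x by (auto intro!: free_lift_closed[OF \<phi>] letter_value_closed[OF \<phi>])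
  have "letter_value G \<phi> x \<otimes> free_lift G \<phi> w =
      (letter_value G \<phi> x \<otimes> letter_value G \<phi> (inv_letter x)) \<otimes> free_lift G \<phi> v"
    using cl by (simp add: v free_lift_Cons m_assoc)
  then show ?thesis using cl v letter_value_inv[OF \<phi> x] by simp
next
  case False
  then have "push_letter x w = x # w" by (cases w) auto
  then show ?thesis by (simp add: free_lift_Cons)
qed

lemma free_lift_hom:
  assumes \<phi>: "\<phi> \<in> X \<rightarrow> carrier G"
  shows "free_lift G \<phi> \<in> hom (free_group X) G"
proof (rule homI)
  fix u assume "u \<in> carrier (free_group X)"
  then show "free_lift G \<phi> u \<in> carrier G"
    by (auto simp: free_group_def intro!: free_lift_closed[OF \<phi>])
next
  fix u v assume "u \<in> carrier (free_group X)" "v \<in> carrier (free_group X)"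
  then have u: "u \<in> lists (X \<times> UNIV)" and v: "v \<in> lists (X \<times> UNIV)"
    by (auto simp: free_group_def)
  have "free_lift G \<phi> (foldr push_letter u v) = free_lift G \<phi> u \<otimes> free_lift G \<phi> v"
    using u
  proof (induction u)
    case Nil
    show ?case using free_lift_closed[OF \<phi> v] by (simp add: free_lift_def)
  next
    case (Cons x u)
    then have x: "fst x \<in> X" and u: "u \<in> lists (X \<times> UNIV)" by auto
    show ?case
      using Cons.IH free_lift_closed[OF \<phi> v] free_lift_closed[OF \<phi> u]
        letter_value_closed[OF \<phi> x]
      by (simp add: free_lift_push[OF \<phi> x foldr_push_in_lists[OF u v]] free_lift_Cons m_assoc)
  qed
  then show "free_lift G \<phi> (u \<otimes>\<^bsub>free_group X\<^esub> v) = free_lift G \<phi> u \<otimes> free_lift G \<phi> v"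
    by (simp add: free_group_def)
qed

lemma free_lift_gen:
  "\<phi> \<in> X \<rightarrow> carrier G \<Longrightarrow> a \<in> X \<Longrightarrow> free_lift G \<phi> (free_gen a) = \<phi> a"
  using letter_value_closed[of \<phi> X "(a, True)"]
  by (simp add: free_lift_def letter_value_def free_gen_def)

lemma free_lift_unique:
  assumes h: "h \<in> hom (free_group X) G" and gen: "\<And>a. a \<in> X \<Longrightarrow> h (free_gen a) = \<phi> a"
    and w: "w \<in> carrier (free_group X)"
  shows "h w = free_lift G \<phi> w"
proof -
  interpret h: group_hom "free_group X" G h
    using h by (simp add: group_hom_def group_hom_axioms_def group_free_group is_group)
  have letter: "h [x] = letter_value G \<phi> x" if x: "fst x \<in> X" for x
  proof (cases "snd x")
    case True
    then have "[x] = free_gen (fst x)" by (simp add: free_gen_def prod_eq_iff)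
    with True x gen show ?thesis by (simp add: letter_value_def)
  next
    case False
    have mem: "[x] \<in> carrier (free_group X)"
      using x by (cases x) (auto simp: free_group_def)
    have "[x] \<otimes>\<^bsub>free_group X\<^esub> free_gen (fst x) = \<one>\<^bsub>free_group X\<^esub>"
      using False by (simp add: free_group_def free_gen_def inv_letter_def)
    then have "[x] = inv\<^bsub>free_group X\<^esub> free_gen (fst x)"
      using h.G.inv_equality[OF _ free_gen_closed[OF x] mem] by simp
    then have "h [x] = inv (h (free_gen (fst x)))"
      using h.hom_inv[OF free_gen_closed[OF x]] by simp
    with False x gen show ?thesis by (simp add: letter_value_def)
  qed
  from w show ?thesis
  proof (induction w)
    case Nil
    then show ?case using h.hom_one by (simp add: free_lift_def free_group_def)
  next
    case (Cons x w)
    then have x: "fst x \<in> X" and red: "reduced (x # w)" and w: "w \<in> carrier (free_group X)"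
      by (auto simp: free_group_def dest: reduced_tl)
    have mem: "[x] \<in> carrier (free_group X)"
      using x by (cases x) (auto simp: free_group_def)
    have "x # w = [x] \<otimes>\<^bsub>free_group X\<^esub> w"
      using red by (simp add: free_group_def push_letter_reduced)
    then have "h (x # w) = h ([x] \<otimes>\<^bsub>free_group X\<^esub> w)" by (rule arg_cong)
    also have "\<dots> = free_lift G \<phi> (x # w)"
      using h.hom_mult[OF mem w] Cons.IH[OF w] letter[OF x] by (simp add: free_lift_Cons)
    finally show ?case .
  qed
qed

end


section \<open>Directed sets and the game\<close>

text \<open>Directed sets are non-empty, so that the players have a move to make.\<close>

definition directed_set :: "'i set \<Rightarrow> ('i \<Rightarrow> 'i \<Rightarrow> bool) \<Rightarrow> bool" where
  "directed_set D leqD \<longleftrightarrow>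
    D \<noteq> {} \<and> reflp_on D leqD \<and> transp_on D leqD \<and>
    (\<forall>p\<in>D. \<forall>q\<in>D. \<exists>r\<in>D. leqD p r \<and> leqD q r)"

definition player_I_wins :: "'i set \<Rightarrow> ('i \<Rightarrow> 'i \<Rightarrow> bool) \<Rightarrow> (nat \<Rightarrow> 'i) \<Rightarrow> bool" where
  "player_I_wins D leqD p \<longleftrightarrow>
    (\<exists>i. \<not> leqD (p (2 * i)) (p (2 * i + 1))) \<or>
    ((\<forall>i. leqD (p (2 * i + 1)) (p (2 * i + 2))) \<and> (\<exists>q\<in>D. \<forall>i. leqD (p i) q))"

definition winning_strategy_II ::
  "'i set \<Rightarrow> ('i \<Rightarrow> 'i \<Rightarrow> bool) \<Rightarrow> ('i list \<Rightarrow> 'i) \<Rightarrow> bool" where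
  "winning_strategy_II D leqD s \<longleftrightarrow>
    s \<in> lists D \<rightarrow> D \<and>
    (\<forall>p. (\<forall>i. p i \<in> D) \<longrightarrow> (\<forall>i. s (map p [0..<2 * i + 1]) = p (2 * i + 1)) \<longrightarrow>
      \<not> player_I_wins D leqD p)"


section \<open>Inverse systems and their limits\<close>

definition inverse_system_sets ::
  "'i set \<Rightarrow> ('i \<Rightarrow> 'i \<Rightarrow> bool) \<Rightarrow> ('i \<Rightarrow> 'a set) \<Rightarrow> ('i \<Rightarrow> 'i \<Rightarrow> 'a \<Rightarrow> 'a) \<Rightarrow> bool" where
  "inverse_system_sets D leqD A f \<longleftrightarrow>
    (\<forall>p\<in>D. A p \<noteq> {}) \<and>
    (\<forall>p\<in>D. \<forall>q\<in>D. leqD p q \<longrightarrow> f p q \<in> A q \<rightarrow> A p) \<and>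
    (\<forall>p\<in>D. \<forall>a\<in>A p. f p p a = a) \<and>
    (\<forall>p\<in>D. \<forall>q\<in>D. \<forall>r\<in>D. leqD p q \<longrightarrow> leqD q r \<longrightarrow>
      (\<forall>a\<in>A r. f p q (f q r a) = f p r a))"

definition inverse_limit_set ::
  "'i set \<Rightarrow> ('i \<Rightarrow> 'i \<Rightarrow> bool) \<Rightarrow> ('i \<Rightarrow> 'a set) \<Rightarrow> ('i \<Rightarrow> 'i \<Rightarrow> 'a \<Rightarrow> 'a) \<Rightarrow> ('i \<Rightarrow> 'a) set"
  where
  "inverse_limit_set D leqD A f =
    {a \<in> \<Pi>\<^sub>E p\<in>D. A p. \<forall>p\<in>D. \<forall>q\<in>D. leqD p q \<longrightarrow> f p q (a q) = a p}"

definition inverse_limit_group ::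
  "'i set \<Rightarrow> ('i \<Rightarrow> 'i \<Rightarrow> bool) \<Rightarrow> ('i \<Rightarrow> 'g monoid) \<Rightarrow> ('i \<Rightarrow> 'i \<Rightarrow> 'g \<Rightarrow> 'g) \<Rightarrow> ('i \<Rightarrow> 'g) monoid"
  where
  "inverse_limit_group D leqD G h =
    (product_group D G)
      \<lparr>carrier := {g \<in> carrier (product_group D G).
        \<forall>p\<in>D. \<forall>q\<in>D. leqD p q \<longrightarrow> h p q (g q) = g p}\<rparr>"

definition gr_obj :: "('i \<Rightarrow> 'a set) \<Rightarrow> 'i \<Rightarrow> ('a \<times> bool) list monoid" where
  "gr_obj A p = free_group (A p)"

definition gr_map ::
  "('i \<Rightarrow> 'a set) \<Rightarrow> ('i \<Rightarrow> 'i \<Rightarrow> 'a \<Rightarrow> 'a) \<Rightarrow> 'i \<Rightarrow> 'i \<Rightarrow> ('a \<times> bool) list \<Rightarrow> ('a \<times> bool) list"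
  where
  "gr_map A f p q = free_lift (gr_obj A p) (\<lambda>a. free_gen (f p q a))"

end

theory Submission
  imports Defs "HOL-Library.Countable_Set_Type" "HOL-Algebra.Free_Abelian_Groups"
begin

text \<open>
  Every element \<open>a\<close> of the limit of the sets gives the element \<open>(x\<^bsub>p,a\<^sub>p\<^esub>)\<^sub>p\<close> of the limit of the
  groups, and these elements form a free basis.

  They are independent: two different elements of the limit differ at all sufficiently large
  indices, so a reduced word in them stays reduced at some index.

  They generate: along \<open>g = (g\<^sub>p)\<^sub>p\<close> the word length is monotone in \<open>p\<close>, as the bonding maps act
  letterwise before cancellation.  If it were unbounded, Player II would win by answering
  in round \<open>i\<close> with an index at which the length exceeds \<open>i\<close>.  Hence the length attains its maximum
  at some \<open>m\<close>; beyond \<open>m\<close> nothing cancels, so the \<open>k\<close>-th letters of the \<open>g\<^sub>p\<close> are compatible and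
  trace out an element of the limit of the sets.
\<close>

section \<open>Maps between free groups induced by maps of generators\<close>

lemma length_push_letter_le: "length (push_letter x w) \<le> Suc (length w)"
  by (cases w) auto

lemma length_foldr_push_le: "length (foldr push_letter u v) \<le> length u + length v"
proof (induction u)
  case (Cons x u)
  then show ?case using length_push_letter_le[of x "foldr push_letter u v"] by simp
qed simp

text \<open>Each push adds at most one letter and a cancelling push removes one, so full length
  leaves no room for a cancellation.\<close>

lemma foldr_push_no_cancel:
  "length (foldr push_letter u []) = length u \<Longrightarrow> foldr push_letter u [] = u"
proof (induction u)
  case (Cons x u)
  have "length (foldr push_letter u []) = length u"
    using Cons.prems length_push_letter_le[of x "foldr push_letter u []"]
      length_foldr_push_le[of u "[]"] by simp
  then have "foldr push_letter u [] = u" by (rule Cons.IH)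
  with Cons.prems show ?case by (cases u) (auto split: if_splits)
qed simp

text \<open>Renaming generators keeps exponents, so a pair of mutually inverse neighbours in
  \<open>w\<close> stays such a pair in the image.\<close>

lemma reduced_of_map: "reduced (map (map_prod \<phi> id) w) \<Longrightarrow> reduced w"
proof (induction w rule: induct_list012)
  case (3 x y zs)
  then show ?case by (auto simp: inv_letter_def)
qed simp_all

lemma letter_value_free_gen:
  assumes "\<phi> (fst x) \<in> Y"
  shows "letter_value (free_group Y) (\<lambda>a. free_gen (\<phi> a)) x = [map_prod \<phi> id x]"
proof -
  interpret group "free_group Y" by (rule group_free_group)
  let ?a = "\<phi> (fst x)"
  have "[(?a, False)] \<otimes>\<^bsub>free_group Y\<^esub> free_gen ?a = \<one>\<^bsub>free_group Y\<^esub>"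
    by (simp add: free_group_def free_gen_def inv_letter_def)
  moreover have "[(?a, False)] \<in> carrier (free_group Y)" using assms by (simp add: free_group_def)
  ultimately have "inv\<^bsub>free_group Y\<^esub> free_gen ?a = [(?a, False)]"
    using inv_equality free_gen_closed[OF assms] by blast
  then show ?thesis by (cases x) (simp add: letter_value_def free_gen_def)
qed

text \<open>Makes the bonding maps computable on words: rename all letters first, cancel afterwards.
  All later arguments about lengths and positions rest on this form.\<close>

lemma free_lift_free_gen:
  assumes "\<phi> \<in> X \<rightarrow> Y" "w \<in> lists (X \<times> UNIV)"
  shows "free_lift (free_group Y) (\<lambda>a. free_gen (\<phi> a)) w
    = foldr push_letter (map (map_prod \<phi> id) w) []"
  using assms(2)
proof (induction w)
  case Nil
  show ?case by (simp add: free_lift_def free_group_def)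
next
  case (Cons x w)
  then have "\<phi> (fst x) \<in> Y" using assms(1) by auto
  with Cons show ?case
    using group.free_lift_Cons[OF group_free_group, of Y "\<lambda>a. free_gen (\<phi> a)" x w]
    by (simp add: letter_value_free_gen) (simp add: free_group_def id_def)
qed

section \<open>Cardinality of free groups\<close>

lemma infinite_free_group: "X \<noteq> {} \<Longrightarrow> infinite (carrier (free_group X))"
proof -
  assume "X \<noteq> {}"
  then obtain a where a: "a \<in> X" by blast
  \<comment> \<open>Powers of a single generator never cancel, and their lengths tell them
    apart.\<close>
  have "reduced (replicate n (a, True))" for n
  proof (induction n)
    case (Suc n)
    then show ?case by (cases n) (auto simp: inv_letter_def)
  qed simp
  then have "range (\<lambda>n. replicate n (a, True)) \<subseteq> carrier (free_group X)"
    using a by (auto simp: free_group_def)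
  moreover have "infinite (range (\<lambda>n::nat. replicate n (a, True)))"
    by (rule range_inj_infinite) (auto intro!: injI simp: replicate_eq_replicate)
  ultimately show ?thesis using finite_subset by blast
qed

lemma countable_free_group: "countable X \<Longrightarrow> countable (carrier (free_group X))"
  by (rule countable_subset[of _ "lists (X \<times> UNIV)"]) (auto simp: free_group_def)

text \<open>The group lies between the generators, embedded by \<open>free_gen\<close>, and all
  lists of signed generators; for infinite \<open>X\<close> both have the cardinality of
  \<open>X\<close>.\<close>

lemma card_of_free_group_infinite:
  assumes "infinite X"
  shows "|carrier (free_group X)| =o |X|"
proof -
  have "|carrier (free_group X)| \<le>o |lists (X \<times> (UNIV :: bool set))|"
    by (rule card_of_mono1) (auto simp: free_group_def)
  moreover have "|lists (X \<times> (UNIV :: bool set))| =o |X \<times> (UNIV :: bool set)|"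
    using assms by (intro card_of_lists_infinite) (auto simp: finite_cartesian_product_iff)
  moreover have "|X \<times> (UNIV :: bool set)| =o |X|"
    using assms by (intro card_of_Times_infinite[THEN conjunct1])
      (auto intro: ordLess_imp_ordLeq finite_ordLess_infinite2)
  moreover have "|X| \<le>o |carrier (free_group X)|"
    by (rule card_of_ordLeqI[of free_gen])
      (auto simp: inj_on_def free_gen_def free_group_def)
  ultimately show ?thesis
    by (meson ordIso_iff_ordLeq ordIso_transitive ordLeq_ordIso_trans)
qed

section \<open>The limit of the free groups\<close>

text \<open>If \<open>l\<close> were unbounded, directedness would provide arbitrarily large values
  above every index. Player II could then drive \<open>l\<close> to infinity along every run, and no
  run would have an upper bound.\<close>

lemma bounded_if_no_winning_strategy_II:
  fixes l :: "'i \<Rightarrow> nat"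
  assumes D: "directed_set D leqD"
    and no: "\<not> (\<exists>s. winning_strategy_II D leqD s)"
    and mono: "\<And>p q. p \<in> D \<Longrightarrow> q \<in> D \<Longrightarrow> leqD p q \<Longrightarrow> l p \<le> l q"
  shows "\<exists>b. \<forall>p\<in>D. l p \<le> b"
proof (rule ccontr)
  assume unb: "\<not> (\<exists>b. \<forall>p\<in>D. l p \<le> b)"
  have ex: "\<exists>r. r \<in> D \<and> leqD p r \<and> n < l r" if p: "p \<in> D" for p n
  proof -
    obtain q where q: "q \<in> D" "n < l q" using unb by (meson not_le)
    then obtain r where "r \<in> D" "leqD p r" "leqD q r"
      using D p unfolding directed_set_def by blast
    with q mono show ?thesis by (meson less_le_trans)
  qed
  obtain d where d: "d \<in> D" using D unfolding directed_set_def by blast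
  \<comment> \<open>The length of the history serves as the round counter. The value
    \<open>d\<close> only makes \<open>s\<close> map into \<open>D\<close>: the empty history never
    occurs on a turn of Player II.\<close>
  define s where "s ps = (if ps = [] then d
    else (SOME r. r \<in> D \<and> leqD (last ps) r \<and> length ps < l r))" for ps
  have s: "s ps \<in> D \<and> leqD (last ps) (s ps) \<and> length ps < l (s ps)"
    if "ps \<in> lists D" "ps \<noteq> []" for ps
  proof -
    have "last ps \<in> D" using that by auto
    from someI_ex[OF ex[OF this]] show ?thesis using that by (simp add: s_def)
  qed
  have "winning_strategy_II D leqD s"
    unfolding winning_strategy_II_def
  proof (intro conjI allI impI)
    show "s \<in> lists D \<rightarrow> D"
    proof
      fix ps assume "ps \<in> lists D"
      then show "s ps \<in> D" using s[of ps] d by (cases "ps = []") (auto simp: s_def)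
    qed
  next
    fix p assume p: "\<forall>i. p i \<in> D" and play: "\<forall>i. s (map p [0..<2 * i + 1]) = p (2 * i + 1)"
    have move: "leqD (p (2 * i)) (p (2 * i + 1)) \<and> 2 * i + 1 < l (p (2 * i + 1))" for i
    proof -
      let ?ps = "map p [0..<2 * i + 1]"
      have "?ps \<in> lists D" "?ps \<noteq> []" "last ?ps = p (2 * i)" "length ?ps = 2 * i + 1"
        using p by auto
      with s[of ?ps] play show ?thesis by metis
    qed
    show "\<not> player_I_wins D leqD p"
    proof
      assume "player_I_wins D leqD p"
      \<comment> \<open>Player II always answers above the last move, so Player I can win only
        through an upper bound \<open>q\<close>. The answer in round \<open>l q\<close> has too
        large a value to lie below \<open>q\<close>.\<close>
      with move obtain q where q: "q \<in> D" "\<forall>i. leqD (p i) q"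
        unfolding player_I_wins_def by blast
      have "l (p (2 * l q + 1)) \<le> l q" using mono p q by blast
      with move[of "l q"] show False by linarith
    qed
  qed
  with no show False by blast
qed

section \<open>Inverse systems and the limit group\<close>

locale set_system =
  fixes D :: "'i set" and leqD :: "'i \<Rightarrow> 'i \<Rightarrow> bool"
    and A :: "'i \<Rightarrow> 'a set" and f :: "'i \<Rightarrow> 'i \<Rightarrow> 'a \<Rightarrow> 'a"
  assumes directed: "directed_set D leqD" and system: "inverse_system_sets D leqD A f"
begin

abbreviation lim_set where "lim_set \<equiv> inverse_limit_set D leqD A f"

abbreviation lim_group where
  "lim_group \<equiv> inverse_limit_group D leqD (gr_obj A) (gr_map A f)"

definition lim_gen :: "('i \<Rightarrow> 'a) \<Rightarrow> 'i \<Rightarrow> ('a \<times> bool) list" where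
  "lim_gen a = (\<lambda>p\<in>D. free_gen (a p))"

text \<open>The generator with \<open>x p = free_gen (gen_index p x)\<close>, for \<open>x\<close> in the image of \<open>lim_gen\<close>.\<close>

definition gen_index :: "'i \<Rightarrow> ('i \<Rightarrow> ('a \<times> bool) list) \<Rightarrow> 'a" where
  "gen_index p x = fst (hd (x p))"

lemma upper_bound:
  assumes "p \<in> D" "q \<in> D" obtains r where "r \<in> D" "leqD p r" "leqD q r"
  using assms directed unfolding directed_set_def by blast

lemma leqD_refl: "p \<in> D \<Longrightarrow> leqD p p"
  using directed unfolding directed_set_def by (auto dest: reflp_onD)

lemma leqD_trans: "leqD p q \<Longrightarrow> leqD q r \<Longrightarrow> p \<in> D \<Longrightarrow> q \<in> D \<Longrightarrow> r \<in> D \<Longrightarrow> leqD p r"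
  using directed unfolding directed_set_def by (auto dest: transp_onD)

lemma f_closed: "p \<in> D \<Longrightarrow> q \<in> D \<Longrightarrow> leqD p q \<Longrightarrow> f p q \<in> A q \<rightarrow> A p"
  using system unfolding inverse_system_sets_def by blast

lemma f_comp: "p \<in> D \<Longrightarrow> q \<in> D \<Longrightarrow> r \<in> D \<Longrightarrow> leqD p q \<Longrightarrow> leqD q r \<Longrightarrow> a \<in> A r \<Longrightarrow>
    f p q (f q r a) = f p r a"
  using system unfolding inverse_system_sets_def by blast

lemma lim_setD:
  assumes "a \<in> lim_set"
  shows "p \<in> D \<Longrightarrow> a p \<in> A p" "a \<in> extensional D"
    "p \<in> D \<Longrightarrow> q \<in> D \<Longrightarrow> leqD p q \<Longrightarrow> f p q (a q) = a p"
  using assms by (auto simp: inverse_limit_set_def PiE_iff)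

lemma gr_map_eq:
  assumes "p \<in> D" "q \<in> D" "leqD p q" "w \<in> carrier (free_group (A q))"
  shows "gr_map A f p q w = foldr push_letter (map (map_prod (f p q) id) w) []"
  unfolding gr_map_def gr_obj_def
  by (rule free_lift_free_gen[OF f_closed]) (use assms in \<open>auto simp: free_group_def\<close>)

lemma gr_map_hom:
  assumes "p \<in> D" "q \<in> D" "leqD p q"
  shows "group_hom (free_group (A q)) (free_group (A p)) (gr_map A f p q)"
proof -
  have "(\<lambda>a. free_gen (f p q a)) \<in> A q \<rightarrow> carrier (free_group (A p))"
    using f_closed[OF assms] by (auto intro!: free_gen_closed)
  then show ?thesis
    by (simp add: group_hom_def group_hom_axioms_def gr_map_def gr_obj_def group_free_group
        group.free_lift_hom)
qed

lemma carrier_lim_group: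
  "g \<in> carrier lim_group \<longleftrightarrow> g \<in> (\<Pi>\<^sub>E p\<in>D. carrier (free_group (A p))) \<and>
    (\<forall>p\<in>D. \<forall>q\<in>D. leqD p q \<longrightarrow> gr_map A f p q (g q) = g p)"
  by (simp add: inverse_limit_group_def gr_obj_def)

lemma lim_groupD:
  assumes "g \<in> carrier lim_group"
  shows "p \<in> D \<Longrightarrow> g p \<in> carrier (free_group (A p))" "g \<in> extensional D"
    "p \<in> D \<Longrightarrow> q \<in> D \<Longrightarrow> leqD p q \<Longrightarrow> gr_map A f p q (g q) = g p"
  using assms by (auto simp: carrier_lim_group PiE_iff)

text \<open>The bonding maps are homomorphisms, so compatibility cuts out a subgroup of the
  product.\<close>

lemma group_lim_group: "group lim_group"
proof -
  interpret P: group "product_group D (gr_obj A)"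
    by (rule product_group) (simp add: gr_obj_def group_free_group)
  let ?H = "{g \<in> carrier (product_group D (gr_obj A)).
        \<forall>p\<in>D. \<forall>q\<in>D. leqD p q \<longrightarrow> gr_map A f p q (g q) = g p}"
  have inv_eq: "inv\<^bsub>product_group D (gr_obj A)\<^esub> g = (\<lambda>p\<in>D. inv\<^bsub>gr_obj A p\<^esub> g p)"
    if "g \<in> (\<Pi>\<^sub>E p\<in>D. carrier (gr_obj A p))" for g
    using that by (rule inv_product_group) (simp add: gr_obj_def group_free_group)
  have hom: "group_hom (gr_obj A q) (gr_obj A p) (gr_map A f p q)"
    if "p \<in> D" "q \<in> D" "leqD p q" for p q
    using gr_map_hom[OF that] by (simp add: gr_obj_def)
  have "subgroup ?H (product_group D (gr_obj A))"
  proof (rule P.subgroupI)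
    show "?H \<noteq> {}"
      using P.one_closed
      by (auto simp: group_hom.hom_one[OF hom] intro!: exI[of _ "\<one>\<^bsub>product_group D (gr_obj A)\<^esub>"])
  next
    fix g assume g: "g \<in> ?H"
    then show "inv\<^bsub>product_group D (gr_obj A)\<^esub> g \<in> ?H"
      using P.inv_closed[of g]
      by (auto simp: inv_eq PiE_iff group_hom.hom_inv[OF hom])
  next
    fix g h assume "g \<in> ?H" "h \<in> ?H"
    then show "g \<otimes>\<^bsub>product_group D (gr_obj A)\<^esub> h \<in> ?H"
      using P.m_closed[of g h]
      by (auto simp: PiE_iff group_hom.hom_mult[OF hom])
  qed auto
  then show ?thesis
    unfolding inverse_limit_group_def by (rule subgroup.subgroup_is_group) (rule P.is_group)
qed

lemma projection_hom:
  assumes "p \<in> D" shows "group_hom lim_group (free_group (A p)) (\<lambda>g. g p)"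
  unfolding group_hom_def group_hom_axioms_def
  using assms group_lim_group group_free_group
  by (auto simp: hom_def lim_groupD) (auto simp: inverse_limit_group_def gr_obj_def)

section \<open>The canonical generators\<close>

lemma lim_gen_closed: "a \<in> lim_set \<Longrightarrow> lim_gen a \<in> carrier lim_group"
proof -
  assume a: "a \<in> lim_set"
  have "gr_map A f p q (free_gen (a q)) = free_gen (a p)"
    if "p \<in> D" "q \<in> D" "leqD p q" for p q
    using that lim_setD[OF a] gr_map_eq[OF that free_gen_closed, of "a q"]
    by (simp add: free_gen_def)
  then show ?thesis
    using lim_setD[OF a] by (auto simp: carrier_lim_group lim_gen_def free_gen_closed)
qed

lemma inj_lim_gen: "inj_on lim_gen lim_set"
proof (rule inj_onI)
  fix a b assume a: "a \<in> lim_set" and b: "b \<in> lim_set" and eq: "lim_gen a = lim_gen b"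
  have "a p = b p" if "p \<in> D" for p
    using fun_cong[OF eq, of p] that by (simp add: lim_gen_def free_gen_def)
  then show "a = b" by (rule extensionalityI[OF lim_setD(2)[OF a] lim_setD(2)[OF b]])
qed

lemma gen_index_lim_gen: "p \<in> D \<Longrightarrow> gen_index p (lim_gen a) = a p"
  by (simp add: gen_index_def lim_gen_def free_gen_def)

text \<open>Lifting and then projecting to \<open>p\<close> is a homomorphism out of a free group,
  hence determined by its values on generators; there it agrees with the renaming by
  \<open>gen_index p\<close>.\<close>

lemma lift_component:
  assumes p: "p \<in> D" and w: "w \<in> carrier (free_group (lim_gen ` lim_set))"
  shows "free_lift lim_group (\<lambda>x. x) w p
    = foldr push_letter (map (map_prod (gen_index p) id) w) []"
proof -
  let ?X = "lim_gen ` lim_set"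
  interpret L: group lim_group by (rule group_lim_group)
  interpret F: group "free_group (A p)" by (rule group_free_group)
  interpret pr: group_hom lim_group "free_group (A p)" "\<lambda>g. g p" by (rule projection_hom[OF p])
  have id: "(\<lambda>x. x) \<in> ?X \<rightarrow> carrier lim_group" using lim_gen_closed by auto
  have gi: "gen_index p \<in> ?X \<rightarrow> A p"
    using p by (auto simp: gen_index_lim_gen lim_setD)
  have "(\<lambda>w. free_lift lim_group (\<lambda>x. x) w p) \<in> hom (free_group ?X) (free_group (A p))"
    using hom_compose[OF L.free_lift_hom[OF id] pr.homh] by (simp add: comp_def)
  then have "free_lift lim_group (\<lambda>x. x) w p
      = free_lift (free_group (A p)) (\<lambda>x. free_gen (gen_index p x)) w"
  proof (rule F.free_lift_unique[OF _ _ w])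
    fix x assume "x \<in> ?X"
    then show "free_lift lim_group (\<lambda>x. x) (free_gen x) p = free_gen (gen_index p x)"
      using p by (auto simp: L.free_lift_gen[OF id] gen_index_lim_gen) (simp add: lim_gen_def)
  qed
  also have "\<dots> = foldr push_letter (map (map_prod (gen_index p) id) w) []"
    by (rule free_lift_free_gen[OF gi]) (use w in \<open>auto simp: free_group_def\<close>)
  finally show ?thesis .
qed

section \<open>Independence of the generators\<close>

lemma eventually_distinct:
  assumes "a \<in> lim_set" "b \<in> lim_set" "a \<noteq> b"
  obtains p where "p \<in> D" "\<And>q. q \<in> D \<Longrightarrow> leqD p q \<Longrightarrow> a q \<noteq> b q"
proof -
  obtain p where "p \<in> D" "a p \<noteq> b p"
    using assms extensionalityI[OF lim_setD(2)[OF assms(1)] lim_setD(2)[OF assms(2)]] by blast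
  \<comment> \<open>If \<open>a\<close> and \<open>b\<close> agreed at some \<open>q\<close> above
    \<open>p\<close>, applying \<open>f p q\<close> would make them agree at
    \<open>p\<close>.\<close>
  then show ?thesis using assms lim_setD(3) that by metis
qed

text \<open>Each of the finitely many neighbouring pairs has a threshold beyond which it does not
  cancel, and directedness yields a common threshold.\<close>

lemma eventually_reduced:
  assumes "reduced w" "w \<in> lists (lim_gen ` lim_set \<times> UNIV)"
  shows "\<exists>p\<in>D. \<forall>q\<in>D. leqD p q \<longrightarrow> reduced (map (map_prod (gen_index q) id) w)"
  using assms
proof (induction w rule: induct_list012)
  case 1
  then show ?case using directed unfolding directed_set_def by auto
next
  case (2 x)
  then show ?case using directed unfolding directed_set_def by auto
next
  case (3 x y zs)
  obtain p where p: "p \<in> D"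
    "\<And>q. q \<in> D \<Longrightarrow> leqD p q \<Longrightarrow> reduced (map (map_prod (gen_index q) id) (y # zs))"
    using "3.IH"(2) "3.prems" by (meson listsE reduced_simps(3))
  obtain a b where ab: "a \<in> lim_set" "b \<in> lim_set" "fst x = lim_gen a" "fst y = lim_gen b"
    using 3 by auto
  have "\<exists>p'\<in>D. \<forall>q\<in>D. leqD p' q \<longrightarrow>
      map_prod (gen_index q) id y \<noteq> inv_letter (map_prod (gen_index q) id x)"
  proof (cases "a = b")
    case True
    \<comment> \<open>Equal generators in a reduced word carry equal exponents, so their images are
      mutually inverse at no index; any threshold serves.\<close>
    with 3 ab have "snd x = snd y" by (auto simp: inv_letter_def prod_eq_iff)
    then show ?thesis using p(1) by (auto simp: inv_letter_def prod_eq_iff)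
  next
    case False
    then obtain p' where "p' \<in> D" "\<And>q. q \<in> D \<Longrightarrow> leqD p' q \<Longrightarrow> b q \<noteq> a q"
      using eventually_distinct[of b a] ab by blast
    then show ?thesis
      using ab by (auto simp: inv_letter_def prod_eq_iff gen_index_lim_gen intro!: bexI[of _ p'])
  qed
  then obtain p' where p': "p' \<in> D" "\<And>q. q \<in> D \<Longrightarrow> leqD p' q \<Longrightarrow>
      map_prod (gen_index q) id y \<noteq> inv_letter (map_prod (gen_index q) id x)" by blast
  obtain r where r: "r \<in> D" "leqD p r" "leqD p' r" using upper_bound p(1) p'(1) by blast
  have "reduced (map (map_prod (gen_index q) id) (x # y # zs))" if q: "q \<in> D" "leqD r q" for q
  proof -
    have "leqD p q" "leqD p' q" using leqD_trans r q p(1) p'(1) by blast+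
    with p(2)[OF q(1)] p'(2)[OF q(1)] show ?thesis by simp
  qed
  with r show ?case by blast
qed

text \<open>A word in the kernel is read at an index where its renaming is reduced: there its value
  is the renamed word itself, which must therefore be empty.\<close>

lemma lift_inj: "inj_on (free_lift lim_group (\<lambda>x. x)) (carrier (free_group (lim_gen ` lim_set)))"
proof -
  let ?X = "lim_gen ` lim_set"
  interpret L: group lim_group by (rule group_lim_group)
  have id: "(\<lambda>x. x) \<in> ?X \<rightarrow> carrier lim_group" using lim_gen_closed by auto
  interpret h: group_hom "free_group ?X" lim_group "free_lift lim_group (\<lambda>x. x)"
    unfolding group_hom_def group_hom_axioms_def
    using group_free_group group_lim_group L.free_lift_hom[OF id] by blast
  have "w = []" if w: "w \<in> carrier (free_group ?X)"
    and one: "free_lift lim_group (\<lambda>x. x) w = \<one>\<^bsub>lim_group\<^esub>" for w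
  proof -
    obtain p where p: "p \<in> D" "reduced (map (map_prod (gen_index p) id) w)"
      using eventually_reduced[of w] w leqD_refl by (auto simp: free_group_def)
    have "map (map_prod (gen_index p) id) w = free_lift lim_group (\<lambda>x. x) w p"
      using lift_component[OF p(1) w] foldr_push_Nil[OF p(2)] by simp
    also have "\<dots> = []"
      using one p(1) by (simp add: inverse_limit_group_def gr_obj_def free_group_def)
    finally show ?thesis by simp
  qed
  then show ?thesis
    by (intro h.inj_on_one_iff[THEN iffD2]) (auto simp: free_group_def)
qed

section \<open>Generation by the canonical generators\<close>

lemma lim_group_eqI:
  assumes g: "g \<in> carrier lim_group" and h: "h \<in> carrier lim_group" and m: "m \<in> D"
    and eq: "\<And>p. p \<in> D \<Longrightarrow> leqD m p \<Longrightarrow> g p = h p"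
  shows "g = h"
proof (rule extensionalityI[OF lim_groupD(2)[OF g] lim_groupD(2)[OF h]])
  fix p assume p: "p \<in> D"
  \<comment> \<open>The coordinate at \<open>p\<close> is the image of the one at \<open>r\<close>,
    where \<open>g\<close> and \<open>h\<close> agree.\<close>
  obtain r where r: "r \<in> D" "leqD p r" "leqD m r" using upper_bound[OF p m] by blast
  show "g p = h p"
    using lim_groupD(3)[OF g p r(1,2)] lim_groupD(3)[OF h p r(1,2)] eq[OF r(1,3)] by simp
qed

text \<open>The indices above \<open>m\<close> are cofinal: the value at \<open>p\<close> is pushed
  down from any index above both \<open>p\<close> and \<open>m\<close>.\<close>

lemma lim_set_extend:
  assumes m: "m \<in> D" and b: "\<And>p. p \<in> D \<Longrightarrow> leqD m p \<Longrightarrow> b p \<in> A p"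
    and comp: "\<And>p q. p \<in> D \<Longrightarrow> q \<in> D \<Longrightarrow> leqD m p \<Longrightarrow> leqD p q \<Longrightarrow> f p q (b q) = b p"
  obtains a where "a \<in> lim_set" "\<And>p. p \<in> D \<Longrightarrow> leqD m p \<Longrightarrow> a p = b p"
proof -
  define r where "r p = (SOME r. r \<in> D \<and> leqD p r \<and> leqD m r)" for p
  have r: "r p \<in> D \<and> leqD p (r p) \<and> leqD m (r p)" if "p \<in> D" for p
    unfolding r_def by (rule someI_ex) (use upper_bound[OF that m] in blast)
  \<comment> \<open>The choice of \<open>r\<close> is immaterial, since both values are pushed down
    from a common upper bound of \<open>s\<close> and \<open>t\<close>.\<close>
  have indep: "f p s (b s) = f p t (b t)"
    if p: "p \<in> D" and s: "s \<in> D" "leqD p s" "leqD m s" and t: "t \<in> D" "leqD p t" "leqD m t"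
    for p s t
  proof -
    obtain u where u: "u \<in> D" "leqD s u" "leqD t u" using upper_bound s t by blast
    have bu: "b u \<in> A u" using b u s m leqD_trans by blast
    have "f p s (b s) = f p u (b u)" using comp[of s u] f_comp[of p s u "b u"] p s u bu by simp
    moreover have "f p t (b t) = f p u (b u)"
      using comp[of t u] f_comp[of p t u "b u"] p t u bu by simp
    ultimately show ?thesis by simp
  qed
  define a where "a = (\<lambda>p\<in>D. f p (r p) (b (r p)))"
  have "f p q (a q) = a p" if pq: "p \<in> D" "q \<in> D" "leqD p q" for p q
  proof -
    \<comment> \<open>As \<open>r q\<close> also lies above \<open>p\<close>, it competes with
      \<open>r p\<close> and \<open>indep\<close> applies.\<close>
    have "f p q (a q) = f p (r q) (b (r q))"
      using f_comp[of p q "r q" "b (r q)"] r[of q] b pq by (simp add: a_def)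
    also have "\<dots> = a p"
      using indep[of p "r q" "r p"] r[of q] r[of p] pq leqD_trans[of p q "r q"] by (simp add: a_def)
    finally show ?thesis .
  qed
  moreover have "a p \<in> A p" if "p \<in> D" for p
    using f_closed[of p "r p"] r[OF that] b that by (auto simp: a_def)
  ultimately have "a \<in> lim_set" by (auto simp: inverse_limit_set_def a_def)
  moreover have "a p = b p" if "p \<in> D" "leqD m p" for p
    \<comment> \<open>Above \<open>m\<close>, the index \<open>p\<close> itself is an admissible
      choice.\<close>
    using indep[of p "r p" p] comp[of p p] r[OF that(1)] that leqD_refl by (simp add: a_def)
  ultimately show thesis using that by blast
qed

lemma length_mono:
  assumes "g \<in> carrier lim_group" "p \<in> D" "q \<in> D" "leqD p q"
  shows "length (g p) \<le> length (g q)"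
  using gr_map_eq[OF assms(2-4) lim_groupD(1)[OF assms(1,3)]] lim_groupD(3)[OF assms]
    length_foldr_push_le[of "map (map_prod (f p q) id) (g q)" "[]"] by simp

lemma lift_surj:
  assumes g: "g \<in> carrier lim_group" and bdd: "\<forall>p\<in>D. length (g p) \<le> b"
  shows "\<exists>w \<in> carrier (free_group (lim_gen ` lim_set)). free_lift lim_group (\<lambda>x. x) w = g"
proof -
  let ?X = "lim_gen ` lim_set"
  interpret L: group lim_group by (rule group_lim_group)
  have id: "(\<lambda>x. x) \<in> ?X \<rightarrow> carrier lim_group" using lim_gen_closed by auto
  obtain m where m: "m \<in> D" and max: "\<And>p. p \<in> D \<Longrightarrow> length (g p) \<le> length (g m)"
  proof -
    let ?S = "(\<lambda>p. length (g p)) ` D"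
    have "finite ?S" "?S \<noteq> {}"
      using bdd directed finite_subset[of ?S "{..b}"] by (auto simp: directed_set_def)
    then have "Max ?S \<in> ?S" "\<And>p. p \<in> D \<Longrightarrow> length (g p) \<le> Max ?S" by (auto intro: Max_in)
    then show ?thesis using that by (metis (no_types, lifting) imageE)
  qed
  have len: "length (g p) = length (g m)" if "p \<in> D" "leqD m p" for p
    using max[OF that(1)] length_mono[OF g m that] by simp
  \<comment> \<open>Lengths are constant above \<open>m\<close>, so by
    \<open>foldr_push_no_cancel\<close> the bonding map merely renames letters and preserves
    positions.\<close>
  have step: "g p = map (map_prod (f p q) id) (g q)"
    if p: "p \<in> D" "leqD m p" and q: "q \<in> D" "leqD p q" for p q
  proof -
    have "leqD m q" using leqD_trans that m by blast
    then have "length (g q) = length (g p)" using len that by simp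
    moreover have "g p = foldr push_letter (map (map_prod (f p q) id) (g q)) []"
      using gr_map_eq[OF p(1) q lim_groupD(1)[OF g q(1)]] lim_groupD(3)[OF g p(1) q] by simp
    ultimately show ?thesis
      using foldr_push_no_cancel[of "map (map_prod (f p q) id) (g q)"] by simp
  qed
  have "\<exists>a. a \<in> lim_set \<and> (\<forall>p\<in>D. leqD m p \<longrightarrow> a p = fst (g p ! k))" if k: "k < length (g m)" for k
  proof -
    have "fst (g p ! k) \<in> A p" if "p \<in> D" "leqD m p" for p
    proof -
      have "g p ! k \<in> set (g p)" using k len[OF that] by simp
      then show ?thesis using lim_groupD(1)[OF g that(1)] by (auto simp: free_group_def)
    qed
    moreover have "f p q (fst (g q ! k)) = fst (g p ! k)"
      if "p \<in> D" "q \<in> D" "leqD m p" "leqD p q" for p q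
      using step[of p q] len[of q] leqD_trans[of m p q] that m k by simp
    ultimately show ?thesis
      using lim_set_extend[OF m, of "\<lambda>p. fst (g p ! k)"] by metis
  qed
  then obtain a where a: "\<And>k. k < length (g m) \<Longrightarrow> a k \<in> lim_set"
    "\<And>k p. k < length (g m) \<Longrightarrow> p \<in> D \<Longrightarrow> leqD m p \<Longrightarrow> a k p = fst (g p ! k)"
    by metis
  \<comment> \<open>The exponents may be read off at \<open>m\<close>, because renaming leaves them
    constant above \<open>m\<close>.\<close>
  define w where "w = map (\<lambda>k. (lim_gen (a k), snd (g m ! k))) [0..<length (g m)]"
  have map_w: "map (map_prod (gen_index p) id) w = g p" if p: "p \<in> D" "leqD m p" for p
  proof (rule nth_equalityI)
    fix k assume "k < length (map (map_prod (gen_index p) id) w)"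
    then have k: "k < length (g m)" by (simp add: w_def)
    have "snd (g m ! k) = snd (g p ! k)"
      using step[OF m leqD_refl[OF m] p] len[OF p] k by (metis nth_map snd_map_prod id_apply)
    then show "map (map_prod (gen_index p) id) w ! k = g p ! k"
      using k a(2)[OF k p] p by (simp add: w_def gen_index_lim_gen prod_eq_iff)
  qed (simp add: w_def len[OF p])
  have "reduced (g m)" using lim_groupD(1)[OF g m] by (simp add: free_group_def)
  then have "reduced w" using map_w[OF m leqD_refl[OF m]] reduced_of_map by metis
  then have w: "w \<in> carrier (free_group ?X)" using a by (auto simp: free_group_def w_def)
  have "free_lift lim_group (\<lambda>x. x) w = g"
  proof (rule lim_group_eqI[OF _ g m])
    show "free_lift lim_group (\<lambda>x. x) w \<in> carrier lim_group"
      using hom_in_carrier[OF L.free_lift_hom[OF id] w] .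
    fix p assume p: "p \<in> D" "leqD m p"
    have "reduced (g p)" using lim_groupD(1)[OF g p(1)] by (simp add: free_group_def)
    then show "free_lift lim_group (\<lambda>x. x) w p = g p"
      using lift_component[OF p(1) w] map_w[OF p] by (simp add: foldr_push_Nil)
  qed
  with w show ?thesis by blast
qed

lemma free_basis_lim_gen:
  assumes "\<not> (\<exists>s. winning_strategy_II D leqD s)"
  shows "free_basis lim_group (lim_gen ` lim_set)"
proof -
  let ?X = "lim_gen ` lim_set"
  interpret L: group lim_group by (rule group_lim_group)
  have id: "(\<lambda>x. x) \<in> ?X \<rightarrow> carrier lim_group" using lim_gen_closed by auto
  have hom: "free_lift lim_group (\<lambda>x. x) \<in> hom (free_group ?X) lim_group"
    by (rule L.free_lift_hom[OF id])
  have "g \<in> free_lift lim_group (\<lambda>x. x) ` carrier (free_group ?X)"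
    if g: "g \<in> carrier lim_group" for g
  proof -
    \<comment> \<open>The game hypothesis enters here, applied to the monotone word length along
      \<open>g\<close>.\<close>
    obtain b where "\<forall>p\<in>D. length (g p) \<le> b"
      using bounded_if_no_winning_strategy_II[OF directed assms, of "\<lambda>p. length (g p)"]
        length_mono[OF g] by blast
    then show ?thesis using lift_surj[OF g] by blast
  qed
  then have "free_lift lim_group (\<lambda>x. x) ` carrier (free_group ?X) = carrier lim_group"
    using hom_in_carrier[OF hom] by blast
  then show ?thesis
    using hom lift_inj id by (auto simp: free_basis_def iso_def bij_betw_def)
qed

end

text \<open>The maximum of aleph_0, which is \<open>natLeq\<close>, and the size of the limit is
  expressed by distinguishing whether the limit is countable.\<close>

theorem theorem3p1:
  fixes D :: "'i set" and leqD :: "'i \<Rightarrow> 'i \<Rightarrow> bool"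
    and A :: "'i \<Rightarrow> 'a set" and f :: "'i \<Rightarrow> 'i \<Rightarrow> 'a \<Rightarrow> 'a"
  assumes "directed_set D leqD"
    and "\<not> (\<exists>s. winning_strategy_II D leqD s)"
    and "inverse_system_sets D leqD A f"
    and "inverse_limit_set D leqD A f \<noteq> {}"
  shows "is_free_group (inverse_limit_group D leqD (gr_obj A) (gr_map A f)) \<and>
    (if |inverse_limit_set D leqD A f| \<le>o natLeq
     then |carrier (inverse_limit_group D leqD (gr_obj A) (gr_map A f))| =o natLeq
     else |carrier (inverse_limit_group D leqD (gr_obj A) (gr_map A f))|
            =o |inverse_limit_set D leqD A f| )"
proof -
  interpret set_system D leqD A f using assms(1,3) by unfold_locales
  let ?X = "lim_gen ` lim_set"
  have basis: "free_basis lim_group ?X" by (rule free_basis_lim_gen[OF assms(2)])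
  then have "is_free_group lim_group" using group_lim_group by (auto simp: is_free_group_def)
  moreover have G: "|carrier (free_group ?X)| =o |carrier lim_group|"
    using basis unfolding free_basis_def iso_def by (blast intro: card_of_ordIsoI)
  have X: "|lim_set| =o |?X|"
    using inj_lim_gen by (blast intro: card_of_ordIsoI inj_on_imp_bij_betw)
  have "|carrier lim_group| =o natLeq" if "|lim_set| \<le>o natLeq"
  proof -
    have "countable ?X" using that by (simp add: countable_card_le_natLeq[symmetric])
    then have "|carrier (free_group ?X)| \<le>o natLeq"
      using countable_free_group countable_card_le_natLeq by blast
    \<comment> \<open>A non-empty limit supplies a generator, whose powers already make the group
      infinite.\<close>
    moreover have "natLeq \<le>o |carrier (free_group ?X)|"
      using infinite_free_group[of ?X] assms(4) infinite_iff_natLeq_ordLeq by blast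
    ultimately show ?thesis
      using G by (meson ordIso_iff_ordLeq ordIso_symmetric ordIso_transitive)
  qed
  moreover have "|carrier lim_group| =o |lim_set|" if "\<not> |lim_set| \<le>o natLeq"
  proof -
    have "infinite lim_set"
      using that countable_finite countable_card_le_natLeq by blast
    then have "infinite ?X" using inj_lim_gen by (simp add: finite_image_iff)
    then have "|carrier (free_group ?X)| =o |?X|" by (rule card_of_free_group_infinite)
    then show ?thesis using G X by (meson ordIso_symmetric ordIso_transitive)
  qed
  ultimately show ?thesis by simp
qed

end
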